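(* For nonnegative integers $r,q$, \[ \sum_{\substack{s_1+\cdots+s_{r+2}=q\\ s_i\ge0}}\eta(s_1+1,s_2+1,\ldots,s_{r+2}+1)=\sum_{\substack{\alpha_1+\cdots+\alpha_{q+1}=r\\ \alpha_i\ge0}}\rho(\alpha_1+1,\ldots,\alpha_q+1,\alpha_{q+1}+2). \]
   Context: For positive integers $\beta_1,\ldots,\beta_k$ with $\beta_1+\cdots+\beta_k>1$, the multiple $\eta$-value is $\eta(\beta_1,\ldots,\beta_k)=\sum_{n=1}^\infty\frac{1}{n^{\beta_1}(n+1)^{\beta_2}\cdots(n+k-1)^{\beta_k}}$. The rising factorial is $(x)_0=1$, $(x)_n=x(x+1)\cdots(x+n-1)$. For nonnegative integers $\alpha_1,\ldots,\alpha_k$ with $\alpha_k\ge1$, the multiple $\rho$-value is \[ \rho(\alpha_1+1,\ldots,\alpha_k+1)=\sum_{1\le n_1<\cdots<n_k}\prod_{j=1}^{k}\frac{1}{(n_j+\alpha_1+\cdots+\alpha_{j-1})_{\alpha_j+1}}. \] *)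

theory Defs
  imports "HOL-Analysis.Analysis"
begin

text \<open>
  Argument tuples are lists, so the one-based entry \<open>\<beta>\<^sub>j\<close> is \<open>bs ! (j - 1)\<close>.
  All series below have nonnegative terms, so their unordered sums agree with the sums in any order.
  The intended domain of \<open>eta\<close> is lists of positive integers with sum greater than 1.
\<close>

definition eta :: "nat list \<Rightarrow> real" where
  "eta bs = (\<Sum>\<^sub>\<infinity>n\<in>{1::nat..}. 1 / (\<Prod>j<length bs. real (n + j) ^ (bs ! j)))"

definition increasing_tuples :: "nat \<Rightarrow> nat list set" where
  "increasing_tuples k = {ns. length ns = k \<and> (\<forall>n\<in>set ns. 1 \<le> n) \<and> sorted_wrt (<) ns}"

text \<open>
  As in the notation \<open>\<rho>(\<alpha>\<^sub>1 + 1, \<dots>, \<alpha>\<^sub>k + 1)\<close>, the list \<open>bs\<close> holds the shifted values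
  \<open>\<alpha>\<^sub>j + 1\<close>; hence \<open>\<alpha>\<^sub>j\<close> is recovered as \<open>bs ! (j - 1) - 1\<close>. The intended domain is
  nonempty lists of positive integers whose last entry is at least 2.
\<close>

definition rho :: "nat list \<Rightarrow> real" where
  "rho bs = (\<Sum>\<^sub>\<infinity>ns\<in>increasing_tuples (length bs).
     \<Prod>j<length bs. 1 / pochhammer (real (ns ! j + (\<Sum>i<j. bs ! i - 1))) (bs ! j))"

definition weak_compositions :: "nat \<Rightarrow> nat \<Rightarrow> nat list set" where
  "weak_compositions k n = {xs. length xs = k \<and> sum_list xs = n}"

end

theory Submission
  imports Defs
begin

text \<open>
  Let \<open>H\<^sub>q(n, k)\<close> be the degree-\<open>q\<close> complete homogeneous polynomial in \<open>1/n, \<dots>, 1/(n+k-1)\<close>,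
  divided by \<open>n \<cdots> (n+k-1)\<close>. Isolating the first or the last variable gives
  \<open>k H\<^sub>q(n, k+1) = H\<^sub>q(n, k) - H\<^sub>q(n+1, k)\<close>, so the sum of eta values telescopes to
  \<open>H\<^sub>q(1, r+1) / (r+1)\<close>.

  Each rho value has a closed form: summing over the outermost (largest) index first, every
  one-dimensional sum telescopes as \<open>\<Sum>\<^bsub>n>M\<^esub> 1/(n)\<^bsub>k+1\<^esub> = 1/(k (M+1)\<^bsub>k\<^esub>)\<close>, and the Pochhammer
  symbol it leaves merges with the factor of the preceding index. The result is
  \<open>1/(r+1)!\<close> times the reciprocals of \<open>\<alpha>\<^sub>j + \<dots> + \<alpha>\<^bsub>q+1\<^esub> + 1\<close>. The sum of these weights over
  all \<open>\<alpha>\<close> satisfies the same recursion in \<open>q\<close> as \<open>r! H\<^sub>q(1, r+1)\<close>.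
\<close>

section \<open>Telescoping and finite addition of unordered sums\<close>

lemma has_sum_telescope:
  fixes f :: "nat \<Rightarrow> real"
  assumes dec: "\<And>n. n \<ge> m \<Longrightarrow> f (Suc n) \<le> f n" and lim: "f \<longlonglongrightarrow> 0"
  shows "((\<lambda>n. f n - f (Suc n)) has_sum f m) {m..}"
proof -
  let ?g = "\<lambda>n. f (n + m)"
  have "?g \<longlonglongrightarrow> 0" using lim by (rule LIMSEQ_ignore_initial_segment)
  from telescope_sums'[OF this]
  have s: "(\<lambda>n. f (n + m) - f (Suc (n + m))) sums f m" by simp
  \<comment> \<open>By \<open>dec\<close> the terms are nonnegative, so convergence of the partial
    sums gives the unordered sum.\<close>
  have "((\<lambda>n. f (n + m) - f (Suc (n + m))) has_sum f m) UNIV"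
    by (rule norm_summable_imp_has_sum[OF _ s]) (use s dec in \<open>auto simp: sums_iff\<close>)
  moreover have "inj (\<lambda>n. n + m)" by simp
  moreover have "range (\<lambda>n. n + m) = {m..}"
    by (auto simp: image_iff) (metis le_add_diff_inverse2)
  ultimately show ?thesis
    using has_sum_reindex[of "\<lambda>n. n + m" UNIV "\<lambda>n. f n - f (Suc n)" "f m"]
    by (simp add: o_def)
qed

lemma has_sum_finite_sum:
  fixes f :: "'i \<Rightarrow> 'a \<Rightarrow> 'b::topological_comm_monoid_add"
  assumes "finite I" "\<And>i. i \<in> I \<Longrightarrow> (f i has_sum S i) A"
  shows "((\<lambda>x. \<Sum>i\<in>I. f i x) has_sum (\<Sum>i\<in>I. S i)) A"
  using assms by (induction I rule: finite_induct) (auto intro: has_sum_add)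

subsection \<open>Weak compositions\<close>

lemma finite_weak_compositions: "finite (weak_compositions k n)"
proof (rule finite_subset)
  show "weak_compositions k n \<subseteq> {xs. set xs \<subseteq> {..n} \<and> length xs = k}"
    using member_le_sum_list by (auto simp: weak_compositions_def)
qed (simp add: finite_lists_length_eq)

lemma weak_compositions_0: "weak_compositions 0 n = (if n = 0 then {[]} else {})"
  by (auto simp: weak_compositions_def)

lemma sum_weak_compositions_Cons:
  fixes f :: "nat list \<Rightarrow> 'a::comm_monoid_add"
  shows "(\<Sum>s\<in>weak_compositions (Suc k) n. f s) =
    (\<Sum>a\<le>n. \<Sum>s\<in>weak_compositions k (n - a). f (a # s))"
proof -
  have "(\<Sum>s\<in>weak_compositions (Suc k) n. f s) =
      (\<Sum>(a, s)\<in>Sigma {..n} (\<lambda>a. weak_compositions k (n - a)). f (a # s))"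
    by (rule sum.reindex_bij_witness[where i = "\<lambda>(a, s). a # s" and j = "\<lambda>s. (hd s, tl s)"])
      (auto simp: weak_compositions_def length_Suc_conv)
  then show ?thesis by (simp add: sum.Sigma finite_weak_compositions)
qed

lemma sum_weak_compositions_snoc:
  fixes f :: "nat list \<Rightarrow> 'a::comm_monoid_add"
  shows "(\<Sum>s\<in>weak_compositions (Suc k) n. f s) =
    (\<Sum>a\<le>n. \<Sum>s\<in>weak_compositions k (n - a). f (s @ [a]))"
proof -
  have "(\<Sum>s\<in>weak_compositions (Suc k) n. f s) =
      (\<Sum>(a, s)\<in>Sigma {..n} (\<lambda>a. weak_compositions k (n - a)). f (s @ [a]))"
    by (rule sum.reindex_bij_witness[where i = "\<lambda>(a, s). s @ [a]" and j = "\<lambda>s. (last s, butlast s)"])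
      (auto simp: weak_compositions_def length_Suc_conv_rev)
  then show ?thesis by (simp add: sum.Sigma finite_weak_compositions)
qed

subsection \<open>The eta side\<close>

definition eta_term :: "nat \<Rightarrow> nat list \<Rightarrow> real" where
  "eta_term n s = (\<Prod>j<length s. 1 / real (n + j) ^ (s ! j + 1))"

lemma eta_term_Nil: "eta_term n [] = 1"
  by (simp add: eta_term_def)

lemma eta_term_Cons: "eta_term n (a # s) = eta_term (Suc n) s / real n ^ (a + 1)"
  unfolding eta_term_def by (simp add: prod.lessThan_Suc_shift del: prod.lessThan_Suc of_nat_add power_Suc)

lemma eta_term_snoc: "eta_term n (s @ [a]) = eta_term n s / real (n + length s) ^ (a + 1)"
  unfolding eta_term_def by (simp add: nth_append)

lemma eta_term_nonneg: "0 \<le> eta_term n s"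
  unfolding eta_term_def by (intro prod_nonneg) auto

lemma eta_term_le_one: "eta_term (Suc n) s \<le> 1"
  unfolding eta_term_def by (intro prod_le_1) (auto simp: divide_le_eq one_le_power simp del: power_Suc)

lemma eta_term_tendsto_0:
  assumes "s \<noteq> []"
  shows "(\<lambda>n. eta_term n s) \<longlonglongrightarrow> 0"
proof -
  obtain a t where s: "s = a # t" using assms by (cases s) auto
  \<comment> \<open>The first factor alone provides the decay; the others, with bases at least
    \<open>n + 1\<close>, are bounded by 1.\<close>
  have "norm (eta_term n s) \<le> 1 / real n" if "n > 0" for n
  proof -
    have "eta_term n s \<le> 1 / real n ^ (a + 1)"
      unfolding s eta_term_Cons using eta_term_le_one by (intro divide_right_mono) auto
    also have "\<dots> \<le> 1 / real n"
      using that self_le_power[of "real n" "a + 1"] by (intro divide_left_mono) auto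
    finally show ?thesis using eta_term_nonneg by simp
  qed
  then have "\<forall>\<^sub>F n in sequentially. norm (eta_term n s) \<le> 1 / real n"
    using eventually_gt_at_top[of "0::nat"] by (rule eventually_mono[rotated])
  then show ?thesis
    by (rule Lim_null_comparison) (rule lim_1_over_n)
qed

text \<open>This is \<open>H\<^sub>q(n, k)\<close>.\<close>

definition eta_sum :: "nat \<Rightarrow> nat \<Rightarrow> nat \<Rightarrow> real" where
  "eta_sum q n k = (\<Sum>s\<in>weak_compositions k q. eta_term n s)"

lemma eta_sum_0: "eta_sum q n 0 = (if q = 0 then 1 else 0)"
  by (simp add: eta_sum_def weak_compositions_0 eta_term_Nil)

lemma eta_sum_nonneg: "0 \<le> eta_sum q n k"
  unfolding eta_sum_def by (intro sum_nonneg eta_term_nonneg)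

lemma eta_sum_Cons: "eta_sum q n (Suc k) = (\<Sum>a\<le>q. eta_sum (q - a) (Suc n) k / real n ^ (a + 1))"
  unfolding eta_sum_def by (simp add: sum_weak_compositions_Cons eta_term_Cons sum_divide_distrib)

lemma eta_sum_snoc: "eta_sum q n (Suc k) = (\<Sum>a\<le>q. eta_sum (q - a) n k / real (n + k) ^ (a + 1))"
proof -
  have "eta_term n (s @ [a]) = eta_term n s / real (n + k) ^ (a + 1)"
    if "s \<in> weak_compositions k m" for s a m
    using that by (simp add: eta_term_snoc weak_compositions_def)
  then show ?thesis
    unfolding eta_sum_def sum_weak_compositions_snoc sum_divide_distrib by simp
qed

text \<open>Expand by the exponent of \<open>1/n\<close>. The factor \<open>n\<close> cancels one
  power: the term \<open>a = 0\<close> leaves only the other variables, and the remaining terms form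
  the same sum in degree \<open>q - 1\<close>.\<close>

lemma eta_sum_drop_first:
  assumes "n > 0"
  shows "real n * eta_sum q n (Suc k) =
    eta_sum q (Suc n) k + (if q = 0 then 0 else eta_sum (q - 1) n (Suc k))"
proof (cases q)
  case (Suc p)
  show ?thesis
    unfolding eta_sum_Cons Suc sum.atMost_Suc_shift
    using assms by (simp add: distrib_left sum_distrib_left)
qed (use assms in \<open>simp add: eta_sum_Cons\<close>)

lemma eta_sum_drop_last:
  assumes "n > 0"
  shows "real (n + k) * eta_sum q n (Suc k) =
    eta_sum q n k + (if q = 0 then 0 else eta_sum (q - 1) n (Suc k))"
proof (cases q)
  case (Suc p)
  have nz: "real (n + k) \<noteq> 0" using assms by simp
  show ?thesis
    unfolding eta_sum_snoc Suc sum.atMost_Suc_shift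
    using nz by (simp add: distrib_left sum_distrib_left del: of_nat_add of_nat_eq_0_iff of_nat_0_eq_iff add_is_0)
qed (use assms in \<open>simp add: eta_sum_snoc\<close>)

text \<open>The degree \<open>q - 1\<close> terms of the two recursions agree, so subtraction leaves
  the factor \<open>(n + k) - n = k\<close>.\<close>

lemma eta_sum_diff:
  assumes "n > 0"
  shows "real k * eta_sum q n (Suc k) = eta_sum q n k - eta_sum q (Suc n) k"
  using eta_sum_drop_first[OF assms, of q k] eta_sum_drop_last[OF assms, of k q]
  by (simp add: algebra_simps)

lemma has_sum_eta_sum:
  assumes "k > 0"
  shows "((\<lambda>n. eta_sum q n (Suc k)) has_sum eta_sum q 1 k / real k) {1..}"
proof -
  have "((\<lambda>n. eta_sum q n k - eta_sum q (Suc n) k) has_sum eta_sum q 1 k) {1..}"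
  proof (rule has_sum_telescope)
    show "eta_sum q (Suc n) k \<le> eta_sum q n k" if "1 \<le> n" for n
    proof -
      have "0 \<le> real k * eta_sum q n (Suc k)" by (simp add: eta_sum_nonneg)
      then show ?thesis using that by (simp add: eta_sum_diff)
    qed
    \<comment> \<open>This is where \<open>k > 0\<close> gives decay: \<open>eta_sum 0 n 0\<close>
      is constantly 1.\<close>
    have "s \<noteq> []" if "s \<in> weak_compositions k q" for s
      using that assms by (auto simp: weak_compositions_def)
    then show "(\<lambda>n. eta_sum q n k) \<longlonglongrightarrow> 0"
      unfolding eta_sum_def by (intro tendsto_null_sum eta_term_tendsto_0)
  qed
  from has_sum_cmult_right[OF this, of "1 / real k"]
  have "((\<lambda>n. (eta_sum q n k - eta_sum q (Suc n) k) / real k) has_sum eta_sum q 1 k / real k) {1..}"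
    by simp
  moreover have "(eta_sum q n k - eta_sum q (Suc n) k) / real k = eta_sum q n (Suc k)"
    if "n \<in> {1..}" for n
    using that assms eta_sum_diff[of n k q] by (simp add: field_simps)
  ultimately show ?thesis by (subst (asm) has_sum_cong) auto
qed

lemma eta_eq_infsum_eta_term: "eta (map (\<lambda>x. x + 1) s) = (\<Sum>\<^sub>\<infinity>n\<in>{1..}. eta_term n s)"
  unfolding eta_def eta_term_def by (simp add: prod_dividef)

text \<open>Each eta series is dominated termwise by the sum over all compositions, hence summable,
  so the finitely many series may be added.\<close>

lemma sum_eta:
  assumes "k > 0"
  shows "(\<Sum>s\<in>weak_compositions (Suc k) q. eta (map (\<lambda>x. x + 1) s)) = eta_sum q 1 k / real k"
proof -
  have summable: "(\<lambda>n. eta_term n s) summable_on {1..}" if "s \<in> weak_compositions (Suc k) q" for s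
  proof (rule summable_on_comparison_test)
    show "(\<lambda>n. eta_sum q n (Suc k)) summable_on {1..}"
      using has_sum_eta_sum[OF assms] by (auto simp: summable_on_def)
    show "eta_term n s \<le> eta_sum q n (Suc k)" for n
      unfolding eta_sum_def
      using that by (intro member_le_sum) (auto simp: eta_term_nonneg finite_weak_compositions)
  qed (rule eta_term_nonneg)
  have "((\<lambda>n. eta_sum q n (Suc k)) has_sum
      (\<Sum>s\<in>weak_compositions (Suc k) q. eta (map (\<lambda>x. x + 1) s))) {1..}"
    unfolding eta_sum_def eta_eq_infsum_eta_term
    by (intro has_sum_finite_sum has_sum_infsum summable finite_weak_compositions)
  then show ?thesis using has_sum_eta_sum[OF assms] has_sum_unique by blast
qed

text \<open>At \<open>n = 1\<close>, multiplying \<open>eta_sum_drop_last\<close> by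
  \<open>r!\<close> turns its factor \<open>r + 1\<close> into \<open>(r + 1)!\<close>; iterating
  down in \<open>r\<close> ends at \<open>eta_sum (Suc q) 1 0 = 0\<close>.\<close>

lemma eta_sum_Suc_eq_sum:
  "fact (Suc r) * eta_sum (Suc q) 1 (Suc r) = (\<Sum>b\<le>r. fact b * eta_sum q 1 (Suc b))"
proof -
  have step: "fact (Suc r) * eta_sum (Suc q) 1 (Suc r) =
      fact r * eta_sum (Suc q) 1 r + fact r * eta_sum q 1 (Suc r)" for r
    using arg_cong[OF eta_sum_drop_last[of 1 r "Suc q"], of "(*) (fact r)"]
    by (simp add: algebra_simps)
  show ?thesis
  proof (induction r)
    case 0
    then show ?case using step[of 0] by (simp add: eta_sum_0)
  next
    case (Suc r)
    then show ?case using step[of "Suc r"] by simp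
  qed
qed

subsection \<open>The rho side\<close>

text \<open>With \<open>x = n + c\<close>, the values of \<open>1/(k (x)_k)\<close> at
  \<open>n\<close> and \<open>n + 1\<close> have common denominator \<open>k (x)_{k+1}\<close> and
  numerators \<open>x + k\<close> and \<open>x\<close>, so their difference is the summand.\<close>

lemma has_sum_inverse_pochhammer:
  assumes "k > 0"
  shows "((\<lambda>n. 1 / pochhammer (real (n + c)) (Suc k)) has_sum
    1 / (real k * pochhammer (real (Suc (M + c))) k)) {M<..}"
proof -
  define f where "f n = 1 / (real k * pochhammer (real (n + c)) k)" for n
  have diff: "f n - f (Suc n) = 1 / pochhammer (real (n + c)) (Suc k)" if "n > 0" for n
  proof -
    define x where "x = real (n + c)"
    have x: "x > 0" "x + real k > 0" using that by (simp_all add: x_def)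
    have pos: "pochhammer x k > 0" "pochhammer (x + 1) k > 0"
      using x by (auto intro!: pochhammer_pos)
    have rec: "pochhammer x (Suc k) = x * pochhammer (x + 1) k" "pochhammer x (Suc k) = pochhammer x k * (x + real k)"
      by (rule pochhammer_rec, rule pochhammer_Suc)
    have "f n - f (Suc n) = 1 / (real k * pochhammer x k) - 1 / (real k * pochhammer (x + 1) k)"
      by (simp add: f_def x_def add_ac)
    also have "1 / (real k * pochhammer x k) = (x + real k) / (real k * pochhammer x (Suc k))"
      unfolding rec(2) using pos x assms by (subst frac_eq_eq) (simp_all add: mult_ac)
    also have "1 / (real k * pochhammer (x + 1) k) = x / (real k * pochhammer x (Suc k))"
      unfolding rec(1) using pos x assms by (simp add: field_simps)
    finally show ?thesis using assms by (simp add: diff_divide_distrib[symmetric] x_def)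
  qed
  have "((\<lambda>n. f n - f (Suc n)) has_sum f (Suc M)) {Suc M..}"
  proof (rule has_sum_telescope)
    show "f (Suc n) \<le> f n" if "Suc M \<le> n" for n
    proof -
      have "0 \<le> 1 / pochhammer (real (n + c)) (Suc k)"
        using that by (intro divide_nonneg_nonneg pochhammer_nonneg) auto
      then have "0 \<le> f n - f (Suc n)" using diff[of n] that by simp
      then show ?thesis by simp
    qed
    \<comment> \<open>The first Pochhammer factor is at least \<open>n\<close> and all others are at
      least 1.\<close>
    have "norm (f n) \<le> 1 / real n" if "n > 0" for n
    proof -
      obtain l where l: "k = Suc l" using assms by (cases k) auto
      have "1 \<le> pochhammer (real (n + c) + 1) l"
        unfolding pochhammer_prod by (rule prod_ge_1) auto
      then have "real n * 1 \<le> real (n + c) * pochhammer (real (n + c) + 1) l"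
        by (intro mult_mono) auto
      also have "\<dots> = 1 * pochhammer (real (n + c)) k" by (simp add: l pochhammer_rec)
      also have "\<dots> \<le> real k * pochhammer (real (n + c)) k"
        using assms by (intro mult_right_mono pochhammer_nonneg) (use that in auto)
      finally show ?thesis using that unfolding f_def
        by (simp add: frac_le)
    qed
    then have "\<forall>\<^sub>F n in sequentially. norm (f n) \<le> 1 / real n"
      using eventually_gt_at_top[of "0::nat"] by (rule eventually_mono[rotated])
    then show "f \<longlonglongrightarrow> 0" by (rule Lim_null_comparison) (rule lim_1_over_n)
  qed
  moreover have "{Suc M..} = {M<..}" by auto
  ultimately have "((\<lambda>n. f n - f (Suc n)) has_sum f (Suc M)) {M<..}" by simp
  then have "((\<lambda>n. 1 / pochhammer (real (n + c)) (Suc k)) has_sum f (Suc M)) {M<..}"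
    by (rule has_sum_cong[THEN iffD1, rotated]) (simp add: diff)
  then show ?thesis by (simp add: f_def)
qed

text \<open>The bound \<open>M\<close> stands for the preceding index: after a head \<open>n\<close>
  the tail ranges over \<open>tuples_above n\<close>, which turns sums over tuples into iterated
  sums.\<close>

definition tuples_above :: "nat \<Rightarrow> nat \<Rightarrow> nat list set" where
  "tuples_above M k = {ns. length ns = k \<and> (\<forall>n\<in>set ns. M < n) \<and> sorted_wrt (<) ns}"

lemma increasing_tuples_eq: "increasing_tuples k = tuples_above 0 k"
  by (auto simp: increasing_tuples_def tuples_above_def)

lemma tuples_above_0: "tuples_above M 0 = {[]}"
  by (auto simp: tuples_above_def)

lemma tuples_above_Suc:
  "tuples_above M (Suc k) = (\<lambda>(n, ns). n # ns) ` Sigma {M<..} (\<lambda>n. tuples_above n k)"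
  by (fastforce simp: tuples_above_def image_iff length_Suc_conv)

text \<open>
  The shift \<open>c\<close> absorbs the entries already split off the front of \<open>bs\<close>, which makes induction
  on \<open>bs\<close> possible.
\<close>

definition rho_term :: "nat \<Rightarrow> nat list \<Rightarrow> nat list \<Rightarrow> real" where
  "rho_term c bs ns = (\<Prod>j<length bs. 1 / pochhammer (real (ns ! j + c + (\<Sum>i<j. bs ! i - 1))) (bs ! j))"

lemma rho_eq_infsum_rho_term:
  "rho bs = (\<Sum>\<^sub>\<infinity>ns\<in>tuples_above 0 (length bs). rho_term 0 bs ns)"
  by (simp add: rho_def rho_term_def increasing_tuples_eq)

lemma rho_term_Nil: "rho_term c [] ns = 1"
  by (simp add: rho_term_def)

lemma rho_term_Cons:
  "rho_term c (b # bs) (n # ns) = rho_term (c + (b - 1)) bs ns / pochhammer (real (n + c)) b"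
  unfolding rho_term_def
  by (simp add: prod.lessThan_Suc_shift sum.lessThan_Suc_shift add_ac
      del: prod.lessThan_Suc sum.lessThan_Suc)

lemma rho_term_nonneg: "0 \<le> rho_term c bs ns"
  unfolding rho_term_def by (intro prod_nonneg ballI divide_nonneg_nonneg) (simp_all only: pochhammer_of_nat of_nat_0_le_iff zero_le_one)

text \<open>The extra unit in the last entry makes the sum over the largest index converge even when
  \<open>last \<alpha> = 0\<close>.\<close>

definition rho_args :: "nat list \<Rightarrow> nat list" where
  "rho_args \<alpha> = map (\<lambda>x. x + 1) (butlast \<alpha>) @ [last \<alpha> + 2]"

text \<open>Each reciprocal is the factor \<open>1/k\<close> left by one telescoped sum, with
  \<open>k\<close> the Pochhammer length accumulated from the current and later entries.\<close>

fun rho_weight :: "nat list \<Rightarrow> real" where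
  "rho_weight [] = 1"
| "rho_weight (a # as) = rho_weight as / real (Suc (sum_list (a # as)))"

text \<open>The induction needs arbitrary \<open>M\<close> and \<open>c\<close>: the sum over the
  tail starts above the head \<open>n\<close> and carries the shift \<open>c + a\<close>.\<close>

lemma has_sum_rho_term:
  assumes "\<alpha> \<noteq> []"
  shows "((\<lambda>ns. rho_term c (rho_args \<alpha>) ns) has_sum
    rho_weight \<alpha> / pochhammer (real (Suc (M + c))) (Suc (sum_list \<alpha>))) (tuples_above M (length \<alpha>))"
  using assms
proof (induction \<alpha> arbitrary: c M rule: list_nonempty_induct)
  case (single a)
  have "((\<lambda>n. rho_term c [a + 2] [n]) has_sum
      1 / (real (Suc a) * pochhammer (real (Suc (M + c))) (Suc a))) {M<..}"
    using has_sum_inverse_pochhammer[of "Suc a" c M] by (simp add: rho_term_Cons rho_term_Nil)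
  moreover have "tuples_above M (length [a]) = (\<lambda>n. [n]) ` {M<..}"
    by (auto simp: tuples_above_Suc tuples_above_0)
  ultimately show ?case
    by (simp add: has_sum_reindex inj_on_def o_def rho_args_def)
next
  case (cons a \<alpha>)
  let ?S = "Sigma {M<..} (\<lambda>n. tuples_above n (length \<alpha>))"
  let ?p = "Suc (sum_list (a # \<alpha>))"
  have args: "rho_args (a # \<alpha>) = Suc a # rho_args \<alpha>"
    using cons.hyps by (simp add: rho_args_def)
  define f where "f = (\<lambda>(n, ns). rho_term c (rho_args (a # \<alpha>)) (n # ns))"
  define g where "g n = rho_weight \<alpha> * (1 / pochhammer (real (n + c)) (Suc ?p))" for n
  have inner: "((\<lambda>ns. f (n, ns)) has_sum g n) (tuples_above n (length \<alpha>))" for n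
  proof -
    \<comment> \<open>The tail's symbol begins at \<open>n + c + a + 1\<close>, just after the last
      factor of the head's symbol, so the two merge.\<close>
    have "pochhammer (real (n + c)) (Suc ?p) =
        pochhammer (real (n + c)) (Suc a) * pochhammer (real (Suc (n + (c + a)))) (Suc (sum_list \<alpha>))"
      using pochhammer_product'[of "real (n + c)" "Suc a" "Suc (sum_list \<alpha>)"]
      by (simp add: add_ac)
    then show ?thesis
      using has_sum_cmult_right[OF cons.IH[of "c + a" n], of "1 / pochhammer (real (n + c)) (Suc a)"]
      by (simp add: f_def g_def args rho_term_Cons mult_ac)
  qed
  have outer: "(g has_sum rho_weight (a # \<alpha>) / pochhammer (real (Suc (M + c))) ?p) {M<..}"
    using has_sum_cmult_right[OF has_sum_inverse_pochhammer[of ?p c M], of "rho_weight \<alpha>"]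
    by (simp add: g_def[abs_def])
  \<comment> \<open>Nonnegativity lets the iterated sum be read as one unordered sum over pairs of
    head and tail.\<close>
  have "f summable_on ?S"
  proof (rule summable_on_SigmaI[OF inner])
    show "g summable_on {M<..}" using outer by (auto simp: summable_on_def)
  qed (simp add: f_def rho_term_nonneg)
  with inner outer have "(f has_sum rho_weight (a # \<alpha>) / pochhammer (real (Suc (M + c))) ?p) ?S"
    by (rule has_sum_SigmaI)
  moreover have "inj_on (\<lambda>(n, ns). n # ns) ?S" by (auto simp: inj_on_def)
  ultimately show ?case
    by (simp only: length_Cons tuples_above_Suc has_sum_reindex) (simp add: f_def o_def case_prod_unfold)
qed

lemma rho_closed_form:
  assumes "\<alpha> \<noteq> []"
  shows "rho (rho_args \<alpha>) = rho_weight \<alpha> / fact (Suc (sum_list \<alpha>))"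
proof -
  have "length (rho_args \<alpha>) = length \<alpha>" using assms by (simp add: rho_args_def)
  then have "rho (rho_args \<alpha>) = rho_weight \<alpha> / pochhammer (real 1) (Suc (sum_list \<alpha>))"
    unfolding rho_eq_infsum_rho_term
    using infsumI[OF has_sum_rho_term[OF assms, of 0 0]] by simp
  then show ?thesis by (simp only: of_nat_1 pochhammer_fact)
qed

text \<open>The head of a composition of \<open>r\<close> contributes \<open>1/(r+1)\<close>
  whatever its value, since its factor depends only on the total. What remains is the recursion
  \<open>eta_sum_Suc_eq_sum\<close>, with \<open>b = r - a\<close> the total of the tail.\<close>

lemma sum_rho_weight:
  "(\<Sum>\<alpha>\<in>weak_compositions (Suc q) r. rho_weight \<alpha>) = fact r * eta_sum q 1 (Suc r)"
proof (induction q arbitrary: r)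
  case 0
  \<comment> \<open>In degree 0 only the all-zero composition occurs, giving
    \<open>1/(r+1)!\<close>; the only weight is \<open>1/(r+1)\<close>.\<close>
  have "fact (Suc r) * eta_sum 0 1 (Suc r) = 1" for r
  proof (induction r)
    case 0
    then show ?case using eta_sum_drop_last[of 1 0 0] by (simp add: eta_sum_0)
  next
    case (Suc r)
    have "fact (Suc (Suc r)) * eta_sum 0 1 (Suc (Suc r)) = fact (Suc r) * eta_sum 0 1 (Suc r)"
      using arg_cong[OF eta_sum_drop_last[of 1 "Suc r" 0], of "(*) (fact (Suc r))"]
      by (simp add: algebra_simps)
    with Suc show ?case by simp
  qed
  moreover have "weak_compositions 1 r = {[r]}"
    by (auto simp: weak_compositions_def length_Suc_conv)
  ultimately show ?case
    by (simp add: field_simps)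
next
  case (Suc q)
  have "(\<Sum>\<alpha>\<in>weak_compositions (Suc (Suc q)) r. rho_weight \<alpha>) =
      (\<Sum>a\<le>r. \<Sum>\<alpha>\<in>weak_compositions (Suc q) (r - a). rho_weight \<alpha> / real (Suc r))"
    unfolding sum_weak_compositions_Cons
    by (intro sum.cong refl) (auto simp: weak_compositions_def)
  also have "\<dots> = (\<Sum>a\<le>r. fact (r - a) * eta_sum q 1 (Suc (r - a))) / real (Suc r)"
    by (simp add: sum_divide_distrib[symmetric] Suc.IH)
  also have "(\<Sum>a\<le>r. fact (r - a) * eta_sum q 1 (Suc (r - a))) = (\<Sum>b\<le>r. fact b * eta_sum q 1 (Suc b))"
    by (rule sum.reindex_bij_witness[where i = "\<lambda>b. r - b" and j = "\<lambda>b. r - b"]) auto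
  also have "\<dots> = fact (Suc r) * eta_sum (Suc q) 1 (Suc r)"
    by (rule eta_sum_Suc_eq_sum[symmetric])
  finally show ?case by simp
qed

section \<open>Comparison of the two sides\<close>

theorem theorem3p1:
  fixes r q :: nat
  shows "(\<Sum>s\<in>weak_compositions (r + 2) q. eta (map (\<lambda>x. x + 1) s)) =
    (\<Sum>\<alpha>\<in>weak_compositions (q + 1) r. rho (map (\<lambda>x. x + 1) (butlast \<alpha>) @ [last \<alpha> + 2]))"
proof -
  \<comment> \<open>Every \<alpha> has total \<open>r\<close>, so the factorial is common to all rho
    values and leaves the sum.\<close>
  have "rho (rho_args \<alpha>) = rho_weight \<alpha> / fact (Suc r)"
    if "\<alpha> \<in> weak_compositions (Suc q) r" for \<alpha>
    using that rho_closed_form[of \<alpha>] by (force simp: weak_compositions_def)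
  then have "(\<Sum>\<alpha>\<in>weak_compositions (q + 1) r. rho (rho_args \<alpha>)) =
      fact r * eta_sum q 1 (Suc r) / fact (Suc r)"
    by (simp add: sum_divide_distrib[symmetric] sum_rho_weight)
  also have "\<dots> = eta_sum q 1 (Suc r) / real (Suc r)"
    by simp
  also have "\<dots> = (\<Sum>s\<in>weak_compositions (r + 2) q. eta (map (\<lambda>x. x + 1) s))"
    using sum_eta[of "Suc r" q] by simp
  finally show ?thesis by (simp add: rho_args_def)
qed

end
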